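(* Let $n\ge 6$ and $m=n-3$. Labelled trichord cycles in $\mathbb{Z}_n$ correspond bijectively to pairs consisting of a valid choice function $F$ together with an Eulerian circuit of $G_F$ with a distinguished starting edge: the cycle $c_0c_1\cdots c_{m-1}$ corresponds to the choice function $F$ assigning to each class $T_k$ the step pair of the unique window realizing $T_k$, and to the Eulerian circuit whose $i$-th edge ($0\le i\le m-1$) is the step pair of the window $(c_i,c_{i+1},c_{i+2})$, starting at the edge with $i=0$. Hence $$A(n)+B(n)=\sum_{F\ \text{valid}} m\cdot \mathrm{ec}(G_F),$$ where $\mathrm{ec}(G_F)$ is the number of Eulerian circuits of $G_F$ modulo cyclic rotation of the edge sequence. Moreover the scalar/zigzag split is read off from $F(T_2)$: under the correspondence a labelled cycle is scalar if $F(T_2)\in\{(1,1),(-1,-1)\}$ and zigzag otherwise.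
   Context: Cycles. For $2\le k\le n-2$ let $T_k$ be the transposition class of the set $\{0,1,k\}\subset\mathbb{Z}_n$. A trichord cycle is a cyclic word $c_0c_1\cdots c_{m-1}$ over $\mathbb{Z}_n$, $m=n-3$ (letters may repeat), such that the windows $\{c_i,c_{i+1},c_{i+2}\}$ (indices mod $m$) are three-element sets and each $T_k$, $2\le k\le n-2$, contains exactly one window. It is labelled if $c_0=0$; labelled cycles are counted as sequences. The cycle is scalar if the ordered triple of the window realizing $T_2$ is a translate of $(0,1,2)$ or $(2,1,0)$, and zigzag otherwise. $A(n)$ and $B(n)$ are the numbers of labelled scalar and labelled zigzag cycles. Forms. The step pair of an ordered window $(c,c+a,c+a+b)$ is $(a,b)\in\mathbb{Z}_n^2$. The six forms of $T_k$ (step pairs of the six orderings of $\{0,1,k\}$) are $\mathrm{I}=(1,k-1)$, $\mathrm{II}=(k,1-k)$, $\mathrm{III}=(-1,k)$, $\mathrm{IV}=(k-1,-k)$, $\mathrm{V}=(-k,1)$, $\mathrm{VI}=(1-k,-1)$. A form $(a,b)$ is viewed as a directed edge $a\to b$ on the node set $\mathbb{Z}_n\setminus\{0\}$ (loops allowed). Choice functions. A choice function $F$ assigns to each class $T_k$, $2\le k\le n-2$, one of its six forms $F(T_k)=(a_k,b_k)$. $G_F$ is the directed multigraph with the $m$ chosen edges $a_k\to b_k$. $F$ is balanced if every node of $G_F$ has in-degree equal to out-degree; closed if $\sum_k a_k\equiv 0\pmod n$; weakly connected if $G_F$ (the nodes incident to chosen edges together with the chosen edges) is connected when edge directions are ignored;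 valid if balanced, closed and weakly connected. An Eulerian circuit of $G_F$ is a cyclic arrangement of all $m$ edges, each used once, in which the head of each edge is the tail of the next. *)

theory Defs
  imports
    "HOL-Library.FuncSet"
    "HOL-Number_Theory.Cong"
    "Graph_Theory.Graph_Theory"
begin

text \<open>
  The group \<open>\<int>/n\<close> is represented by the residues \<open>0, \<dots>, n - 1\<close> of type \<^typ>\<open>int\<close>; all other
  integers (such as \<open>-1\<close> or \<open>1 - k\<close>) are reduced with \<open>mod int n\<close>.
\<close>

definition Zn :: "nat \<Rightarrow> int set" where
  "Zn n = {0..<int n}"

definition translate :: "nat \<Rightarrow> int \<Rightarrow> int set \<Rightarrow> int set" where
  "translate n t S = (\<lambda>x. (x + t) mod int n) ` S"

definition trichord_class :: "nat \<Rightarrow> nat \<Rightarrow> int set set" where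
  "trichord_class n k = (\<lambda>t. translate n t {0, 1, int k}) ` Zn n"

definition class_indices :: "nat \<Rightarrow> nat set" where
  "class_indices n = {2..n - 2}"


section \<open>Trichord cycles\<close>

text \<open>Indices are cyclic: the word \<open>c\<close> is a list whose positions are read modulo its length.\<close>

definition window :: "int list \<Rightarrow> nat \<Rightarrow> int \<times> int \<times> int" where
  "window c i = (c ! (i mod length c), c ! ((i + 1) mod length c), c ! ((i + 2) mod length c))"

fun triple_set :: "int \<times> int \<times> int \<Rightarrow> int set" where
  "triple_set (x, y, z) = {x, y, z}"

definition realizes :: "nat \<Rightarrow> int list \<Rightarrow> nat \<Rightarrow> nat \<Rightarrow> bool" where
  "realizes n c i k \<longleftrightarrow> i < length c \<and> triple_set (window c i) \<in> trichord_class n k"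

text \<open>Windows are counted by their position in the cycle, not merely as sets.\<close>

definition trichord_cycle :: "nat \<Rightarrow> int list \<Rightarrow> bool" where
  "trichord_cycle n c \<longleftrightarrow>
     length c = n - 3 \<and> set c \<subseteq> Zn n \<and>
     (\<forall>i<length c. card (triple_set (window c i)) = 3) \<and>
     (\<forall>k\<in>class_indices n. \<exists>!i. realizes n c i k)"

definition labelled_cycle :: "nat \<Rightarrow> int list \<Rightarrow> bool" where
  "labelled_cycle n c \<longleftrightarrow> trichord_cycle n c \<and> c ! 0 = 0"

definition realizing_window :: "nat \<Rightarrow> int list \<Rightarrow> nat \<Rightarrow> int \<times> int \<times> int" where
  "realizing_window n c k = window c (THE i. realizes n c i k)"

fun translate_triple :: "nat \<Rightarrow> int \<Rightarrow> int \<times> int \<times> int \<Rightarrow> int \<times> int \<times> int" where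
  "translate_triple n t (x, y, z) = ((x + t) mod int n, (y + t) mod int n, (z + t) mod int n)"

definition scalar_cycle :: "nat \<Rightarrow> int list \<Rightarrow> bool" where
  "scalar_cycle n c \<longleftrightarrow>
     (\<exists>t\<in>Zn n. realizing_window n c 2 = translate_triple n t (0, 1, 2) \<or>
               realizing_window n c 2 = translate_triple n t (2, 1, 0))"

definition zigzag_cycle :: "nat \<Rightarrow> int list \<Rightarrow> bool" where
  "zigzag_cycle n c \<longleftrightarrow> \<not> scalar_cycle n c"

definition num_scalar :: "nat \<Rightarrow> nat" where
  "num_scalar n = card {c. labelled_cycle n c \<and> scalar_cycle n c}"

definition num_zigzag :: "nat \<Rightarrow> nat" where
  "num_zigzag n = card {c. labelled_cycle n c \<and> zigzag_cycle n c}"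


section \<open>Forms and choice functions\<close>

fun step_pair :: "nat \<Rightarrow> int \<times> int \<times> int \<Rightarrow> int \<times> int" where
  "step_pair n (x, y, z) = ((y - x) mod int n, (z - y) mod int n)"

definition mod_pair :: "nat \<Rightarrow> int \<times> int \<Rightarrow> int \<times> int" where
  "mod_pair n p = (fst p mod int n, snd p mod int n)"

definition forms :: "nat \<Rightarrow> nat \<Rightarrow> (int \<times> int) set" where
  "forms n k = mod_pair n `
     {(1, int k - 1), (int k, 1 - int k), (- 1, int k),
      (int k - 1, - int k), (- int k, 1), (1 - int k, - 1)}"

text \<open>
  A choice function is indexed by \<open>k\<close> rather than by the class of \<open>{0, 1, k}\<close>; it is undefined
  outside \<open>2 \<le> k \<le> n - 2\<close>, so that there are only finitely many and no spurious ones.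
\<close>

definition choice_functions :: "nat \<Rightarrow> (nat \<Rightarrow> int \<times> int) set" where
  "choice_functions n = (\<Pi>\<^sub>E k\<in>class_indices n. forms n k)"

text \<open>
  The arcs of the multigraph are the indices \<open>k\<close>, so there is one arc for each class even if two
  arcs have the same ends. The vertices are exactly the nodes incident with an arc.
\<close>

definition choice_graph :: "nat \<Rightarrow> (nat \<Rightarrow> int \<times> int) \<Rightarrow> (int, nat) pre_digraph" where
  "choice_graph n F =
     \<lparr> verts = fst ` F ` class_indices n \<union> snd ` F ` class_indices n,
       arcs = class_indices n,
       tail = (\<lambda>k. fst (F k)),
       head = (\<lambda>k. snd (F k)) \<rparr>"

definition balanced_choice :: "nat \<Rightarrow> (nat \<Rightarrow> int \<times> int) \<Rightarrow> bool" where
  "balanced_choice n F \<longleftrightarrow>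
     (\<forall>v\<in>verts (choice_graph n F).
        in_degree (choice_graph n F) v = out_degree (choice_graph n F) v)"

definition closed_choice :: "nat \<Rightarrow> (nat \<Rightarrow> int \<times> int) \<Rightarrow> bool" where
  "closed_choice n F \<longleftrightarrow> [(\<Sum>k\<in>class_indices n. fst (F k)) = 0] (mod int n)"

text \<open>The library's notion of connectedness for digraphs ignores the directions of the arcs.\<close>

definition valid_choice :: "nat \<Rightarrow> (nat \<Rightarrow> int \<times> int) \<Rightarrow> bool" where
  "valid_choice n F \<longleftrightarrow>
     F \<in> choice_functions n \<and> balanced_choice n F \<and> closed_choice n F \<and>
     Digraph_Component.connected (choice_graph n F)"


section \<open>Eulerian circuits\<close>

definition euler_circuit_list :: "('a, 'b) pre_digraph \<Rightarrow> 'b list \<Rightarrow> bool" where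
  "euler_circuit_list G es \<longleftrightarrow> (\<exists>u. pre_digraph.euler_trail G u es u)"

definition rotation_class :: "'b list \<Rightarrow> 'b list set" where
  "rotation_class es = range (\<lambda>r. rotate r es)"

text \<open>An Eulerian circuit is a cyclic arrangement, that is, a rotation class of lists of arcs.\<close>

definition euler_circuits :: "('a, 'b) pre_digraph \<Rightarrow> 'b list set set" where
  "euler_circuits G = rotation_class ` {es. euler_circuit_list G es}"

definition ec :: "('a, 'b) pre_digraph \<Rightarrow> nat" where
  "ec G = card (euler_circuits G)"

definition rooted_circuits :: "('a, 'b) pre_digraph \<Rightarrow> ('b list set \<times> 'b) set" where
  "rooted_circuits G = euler_circuits G \<times> arcs G"

lemma cas_iff_nth:
  "es \<noteq> [] \<Longrightarrow> pre_digraph.cas G u es v \<longleftrightarrow>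
     tail G (es ! 0) = u \<and> head G (last es) = v \<and>
     (\<forall>i. Suc i < length es \<longrightarrow> head G (es ! i) = tail G (es ! Suc i))"
proof (induction es arbitrary: u)
  case (Cons e es)
  show ?case
  proof (cases "es = []")
    case True
    then show ?thesis by (auto simp: pre_digraph.cas.simps)
  next
    case False
    have "(\<forall>i. Suc i < length (e # es) \<longrightarrow> head G ((e # es) ! i) = tail G ((e # es) ! Suc i)) \<longleftrightarrow>
      head G e = tail G (es ! 0) \<and>
      (\<forall>i. Suc i < length es \<longrightarrow> head G (es ! i) = tail G (es ! Suc i))"
      using False by (auto simp: nth_Cons split: nat.splits)
    with False Cons.IH[OF False] show ?thesis
      by (auto simp: pre_digraph.cas.simps)
  qed
qed simp

text \<open>
  On the graphs considered here, the library notion is the expected one: each arc is used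
  once and the head of each arc is the tail of the cyclically next one.
\<close>

lemma euler_circuit_list_iff:
  assumes "arcs G \<noteq> {}" and "verts G = tail G ` arcs G \<union> head G ` arcs G"
  shows "euler_circuit_list G es \<longleftrightarrow>
    distinct es \<and> set es = arcs G \<and>
    (\<forall>i<length es. head G (es ! i) = tail G (es ! (Suc i mod length es)))"
proof (cases "set es = arcs G")
  case True
  then have ne: "es \<noteq> []" using assms(1) by auto
  interpret wf_digraph G by unfold_locales (auto simp: assms(2))
  have cyc: "(\<exists>u. cas u es u) \<longleftrightarrow>
    (\<forall>i<length es. head G (es ! i) = tail G (es ! (Suc i mod length es)))" (is "?L \<longleftrightarrow> ?R")
  proof -
    have "?L \<longleftrightarrow> head G (last es) = tail G (es ! 0) \<and>
      (\<forall>i. Suc i < length es \<longrightarrow> head G (es ! i) = tail G (es ! Suc i))"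
      using ne by (auto simp: cas_iff_nth)
    also have "\<dots> \<longleftrightarrow> ?R"
    proof safe
      fix i assume *: "head G (last es) = tail G (es ! 0)"
        "\<forall>i. Suc i < length es \<longrightarrow> head G (es ! i) = tail G (es ! Suc i)" "i < length es"
      show "head G (es ! i) = tail G (es ! (Suc i mod length es))"
      proof (cases "Suc i < length es")
        case False
        with *(3) have "Suc i = length es" by simp
        then show ?thesis using *(1) ne by (metis diff_Suc_1 last_conv_nth mod_self)
      qed (use * in simp)
    next
      assume R: ?R
      have "length es - 1 < length es" "Suc (length es - 1) = length es" using ne by auto
      with R show "head G (last es) = tail G (es ! 0)"
        by (metis last_conv_nth mod_self ne)
      fix i assume "Suc i < length es"
      with R show "head G (es ! i) = tail G (es ! Suc i)"
        by (metis Suc_lessD mod_less)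
    qed
    finally show ?thesis .
  qed
  have "u \<in> verts G \<and> set (awalk_verts u es) = verts G" if "cas u es u" for u
  proof
    show "set (awalk_verts u es) = verts G"
      using set_awalk_verts_not_Nil_cas[OF that ne] True assms(2) by simp
    have "u = tail G (es ! 0)" using that ne by (simp add: cas_iff_nth)
    with True ne show "u \<in> verts G" by (metis nth_mem length_greater_0_conv tail_in_verts)
  qed
  with True show ?thesis
    unfolding cyc[symmetric] euler_circuit_list_def euler_trail_def trail_def awalk_def by auto
qed (auto simp: euler_circuit_list_def pre_digraph.euler_trail_def)


section \<open>The correspondence\<close>

definition cycle_choice :: "nat \<Rightarrow> int list \<Rightarrow> nat \<Rightarrow> int \<times> int" where
  "cycle_choice n c = (\<lambda>k\<in>class_indices n. step_pair n (realizing_window n c k))"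

text \<open>
  The list of the arcs whose ends are the successive step pairs; the arc with given ends is
  unique because a step pair determines the class of its window.
\<close>

definition cycle_arcs :: "nat \<Rightarrow> int list \<Rightarrow> nat list" where
  "cycle_arcs n c =
     map (\<lambda>i. THE e. e \<in> arcs (choice_graph n (cycle_choice n c)) \<and>
                arc_to_ends (choice_graph n (cycle_choice n c)) e = step_pair n (window c i))
         [0..<length c]"

definition correspondence :: "nat \<Rightarrow> int list \<Rightarrow> (nat \<Rightarrow> int \<times> int) \<times> nat list set \<times> nat" where
  "correspondence n c =
     (cycle_choice n c, rotation_class (cycle_arcs n c), cycle_arcs n c ! 0)"

end

theory Submission
  imports Defs
begin

text \<open>
  A step pair determines the class of its window, since the sets of forms of different classes are
  disjoint, and there are as many windows as classes. So a labelled cycle orders all the classes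
  by the positions of their windows. Consecutive windows overlap in a step, which makes this order
  an Eulerian circuit; Eulerian circuits exist only in connected balanced graphs, and the first
  steps of all the windows add up to zero around the cycle. Conversely, the partial sums of the
  tails along an Eulerian circuit give back the cycle: closedness makes the word cyclic. Finally,
  no two rotations of a list of distinct arcs start alike, so a rotation class
  with a starting arc is the same as such a list.
\<close>

section \<open>Forms\<close>

text \<open>Recovers a letter \<open>y\<close> of a word from a neighbouring letter \<open>x\<close>
  and the step between them, known only modulo \<open>N\<close>.\<close>

lemma eq_mod_of_cong_diff:
  fixes N x y a :: int
  assumes "0 \<le> y" "y < N" "(y - x) mod N = a mod N"
  shows "y = (a + x) mod N"
  using mod_add_cong[OF assms(3) refl, of x] assms(1,2) by simp

text \<open>With the representatives below \<open>n\<close> written out, comparing forms becomes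
  linear arithmetic without \<open>mod\<close>.\<close>

lemma forms_eq:
  assumes "k \<in> class_indices n" "n \<ge> 2"
  shows "forms n k =
    {(1, int k - 1), (int k, int n + 1 - int k), (int n - 1, int k),
     (int k - 1, int n - int k), (int n - int k, 1), (int n + 1 - int k, int n - 1)}"
proof -
  have k: "2 \<le> k" "k \<le> n - 2" "k < n" using assms by (auto simp: class_indices_def)
  have 1: "1 mod int n = 1" "(int k - 1) mod int n = int k - 1" "int k mod int n = int k"
    using k by auto
  have neg: "(- a) mod int n = int n - a" if "0 < a" "a < int n" for a
    using that by (simp add: zmod_zminus1_eq_if)
  have 2: "(1 - int k) mod int n = int n + 1 - int k" "(- int k) mod int n = int n - int k"
      "(- 1) mod int n = int n - 1"
    using neg[of "int k - 1"] neg[of "int k"] neg[of 1] k by auto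
  show ?thesis by (simp add: forms_def mod_pair_def 1 2)
qed

text \<open>Nonzero steps whose sum is nonzero modulo \<open>n\<close> mean that the three letters
  of a window differ. As \<open>0 < a + b < 2 * n\<close>, the only multiple of \<open>n\<close> to
  exclude is \<open>n\<close> itself.\<close>

lemma forms_bounds:
  assumes "(a, b) \<in> forms n k" "k \<in> class_indices n" "n \<ge> 2"
  shows "0 < a" "a < int n" "0 < b" "b < int n" "a + b \<noteq> int n"
proof -
  have k: "2 \<le> k" "int k \<le> int n - 2" using assms by (auto simp: class_indices_def)
  show "0 < a" "a < int n" "0 < b" "b < int n" "a + b \<noteq> int n"
    using assms(1) k unfolding forms_eq[OF assms(2,3)] by auto
qed

text \<open>The range of the indices matters: form IV for \<open>k = 2\<close> is
  \<open>(1, n - 2)\<close>, which would also be form I for \<open>k = n - 1\<close>. Within the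
  range, equality of two listed pairs forces equal indices.\<close>

lemma forms_disjoint:
  assumes "p \<in> forms n k" "p \<in> forms n l" "k \<in> class_indices n" "l \<in> class_indices n" "n \<ge> 2"
  shows "k = l"
proof -
  have k: "2 \<le> k" "int k \<le> int n - 2" "2 \<le> l" "int l \<le> int n - 2"
    using assms by (auto simp: class_indices_def)
  show ?thesis
    using assms(1,2) k unfolding forms_eq[OF assms(3,5)] forms_eq[OF assms(4,5)] by auto
qed

section \<open>Windows and their step pairs\<close>

lemma card_triple_set_of_forms:
  assumes "step_pair n w \<in> forms n k" "k \<in> class_indices n" "n \<ge> 2"
  shows "card (triple_set w) = 3"
proof -
  obtain x y z where w: "w = (x, y, z)" by (cases w)
  have n_pos: "int n > 0" using assms(3) by simp
  note b = forms_bounds[OF assms(1)[unfolded w step_pair.simps] assms(2,3)]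
  have "x \<noteq> y" "y \<noteq> z" using b by auto
  moreover have "x \<noteq> z"
  proof
    assume "x = z"
    then have "((y - x) mod int n + (z - y) mod int n) mod int n = 0"
      by (simp add: mod_add_eq)
    \<comment> \<open>A multiple of \<open>n\<close> strictly between \<open>0\<close> and
      \<open>2 * n\<close> is \<open>n\<close>, which \<open>forms_bounds\<close> excludes.\<close>
    then have "int n dvd ((y - x) mod int n + (z - y) mod int n)" by presburger
    then obtain q where q: "(y - x) mod int n + (z - y) mod int n = int n * q" by blast
    then have "int n * 0 < int n * q" "int n * q < int n * 2" using b by linarith+
    then have "0 < q" "q < 2" using n_pos by (simp_all add: zero_less_mult_iff mult_less_cancel_left_pos)
    then have "q = 1" by simp
    with q b show False by simp
  qed
  ultimately show ?thesis by (simp add: w)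
qed

text \<open>The six forms are the step pairs of the six orderings of a translate of
  \<open>{0, 1, k}\<close>. From left to right, \<open>(x, y, z)\<close> is one of these orderings;
  from right to left, each form tells which letter plays \<open>0\<close>, \<open>1\<close> or
  \<open>k\<close>.\<close>

lemma triple_set_in_trichord_class_iff:
  assumes "x \<in> Zn n" "y \<in> Zn n" "z \<in> Zn n" and k: "k \<in> class_indices n" and n: "n \<ge> 2"
  shows "{x, y, z} \<in> trichord_class n k \<longleftrightarrow> step_pair n (x, y, z) \<in> forms n k"
proof
  let ?N = "int n"
  assume "{x, y, z} \<in> trichord_class n k"
  then obtain t where "{x, y, z} = translate n t {0, 1, int k}"
    by (auto simp: trichord_class_def)
  moreover define p q r where "p = t mod ?N" "q = (1 + t) mod ?N" "r = (int k + t) mod ?N"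
  ultimately have eq: "{x, y, z} = {p, q, r}" by (simp add: translate_def)
  have steps: "step_pair n (p, q, r) = mod_pair n (1, int k - 1)"
      "step_pair n (p, r, q) = mod_pair n (int k, 1 - int k)"
      "step_pair n (q, p, r) = mod_pair n (- 1, int k)"
      "step_pair n (q, r, p) = mod_pair n (int k - 1, - int k)"
      "step_pair n (r, p, q) = mod_pair n (- int k, 1)"
      "step_pair n (r, q, p) = mod_pair n (1 - int k, - 1)"
    by (simp_all add: p_q_r_def mod_pair_def mod_diff_eq)
  \<comment> \<open>Form I of \<open>(p, q, r)\<close> shows that the translate has three elements,
    so \<open>x\<close>, \<open>y\<close>, \<open>z\<close> are a permutation of \<open>p\<close>,
    \<open>q\<close>, \<open>r\<close>.\<close>
  have "card {p, q, r} = 3"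
    using card_triple_set_of_forms[OF _ k n, of "(p, q, r)"] unfolding steps by (simp add: forms_def)
  with eq have "card {x, y, z} = 3" "card {p, q, r} = 3" by simp_all
  then have "x \<noteq> y" "y \<noteq> z" "x \<noteq> z" by (auto simp: card_insert_if split: if_splits)
  moreover have "x \<in> {p, q, r}" "y \<in> {p, q, r}" "z \<in> {p, q, r}"
    using eq by blast+
  ultimately have "(x, y, z) \<in> {(p, q, r), (p, r, q), (q, p, r), (q, r, p), (r, p, q), (r, q, p)}"
    by auto
  then show "step_pair n (x, y, z) \<in> forms n k"
    using steps unfolding forms_def by fastforce
next
  let ?N = "int n"
  assume "step_pair n (x, y, z) \<in> forms n k"
  \<comment> \<open>The letters \<open>t\<close>, \<open>u\<close>, \<open>v\<close> play
    \<open>0\<close>, \<open>1\<close>, \<open>k\<close>; only the two differences from the base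
    letter \<open>t\<close> have to be found.\<close>
  have tr: "{x, y, z} \<in> trichord_class n k"
    if "t \<in> Zn n" "{x, y, z} = {t, u, v}" "(u - t) mod ?N = 1 mod ?N" "(v - t) mod ?N = int k mod ?N"
      "u \<in> Zn n" "v \<in> Zn n" for t u v
  proof -
    have "0 \<le> u" "u < ?N" "0 \<le> v" "v < ?N" "t mod ?N = t"
      using that(1,5,6) by (simp_all add: Zn_def)
    then have "u = (1 + t) mod ?N" "v = (int k + t) mod ?N" "t mod ?N = t"
      using that(3,4) by (blast intro: eq_mod_of_cong_diff)+
    then have "{x, y, z} = translate n t {0, 1, int k}" using that(2)
      by (simp add: translate_def add.commute)
    then show ?thesis using that(1) by (auto simp: trichord_class_def)
  qed
  have sum: "(c - a) mod ?N = (d + e) mod ?N"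
    if "(b - a) mod ?N = d mod ?N" "(c - b) mod ?N = e mod ?N" for a b c d e
    using mod_add_cong[OF that] by simp
  have neg: "(a - b) mod ?N = (- d) mod ?N" if "(b - a) mod ?N = d mod ?N" for a b d
    using mod_minus_cong[OF that] by simp
  \<comment> \<open>The base letter is \<open>x\<close> in forms I and II, \<open>y\<close> in III
    and V, and \<open>z\<close> in IV and VI; \<open>sum\<close> and \<open>neg\<close> produce the
    differences from it.\<close>
  consider "(y - x) mod ?N = 1 mod ?N" "(z - y) mod ?N = (int k - 1) mod ?N"
    | "(y - x) mod ?N = int k mod ?N" "(z - y) mod ?N = (1 - int k) mod ?N"
    | "(y - x) mod ?N = (- 1) mod ?N" "(z - y) mod ?N = int k mod ?N"
    | "(y - x) mod ?N = (int k - 1) mod ?N" "(z - y) mod ?N = (- int k) mod ?N"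
    | "(y - x) mod ?N = (- int k) mod ?N" "(z - y) mod ?N = 1 mod ?N"
    | "(y - x) mod ?N = (1 - int k) mod ?N" "(z - y) mod ?N = (- 1) mod ?N"
    using \<open>step_pair n (x, y, z) \<in> forms n k\<close> by (auto simp: forms_def mod_pair_def)
  then show "{x, y, z} \<in> trichord_class n k"
  proof cases
    case 1
    have e: "(y - x) mod ?N = 1 mod ?N" "(z - x) mod ?N = int k mod ?N"
      using 1(1) sum[OF 1] by (simp_all add: algebra_simps)
    show ?thesis
      by (rule tr[OF assms(1) _ e assms(2) assms(3)]) auto
  next
    case 2
    have e: "(z - x) mod ?N = 1 mod ?N" "(y - x) mod ?N = int k mod ?N"
      using sum[OF 2] 2(1) by (simp_all add: algebra_simps)
    show ?thesis
      by (rule tr[OF assms(1) _ e assms(3) assms(2)]) auto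
  next
    case 3
    have e: "(x - y) mod ?N = 1 mod ?N" "(z - y) mod ?N = int k mod ?N"
      using neg[OF 3(1)] 3(2) by (simp_all add: algebra_simps)
    show ?thesis
      by (rule tr[OF assms(2) _ e assms(1) assms(3)]) auto
  next
    case 4
    have e: "(x - z) mod ?N = 1 mod ?N" "(y - z) mod ?N = int k mod ?N"
      using neg[OF sum[OF 4]] neg[OF 4(2)] by (simp_all add: algebra_simps)
    show ?thesis
      by (rule tr[OF assms(3) _ e assms(1) assms(2)]) auto
  next
    case 5
    have e: "(z - y) mod ?N = 1 mod ?N" "(x - y) mod ?N = int k mod ?N"
      using 5(2) neg[OF 5(1)] by (simp_all add: algebra_simps)
    show ?thesis
      by (rule tr[OF assms(2) _ e assms(3) assms(1)]) auto
  next
    case 6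
    have e: "(y - z) mod ?N = 1 mod ?N" "(x - z) mod ?N = int k mod ?N"
      using neg[OF 6(2)] neg[OF sum[OF 6]] by (simp_all add: algebra_simps)
    show ?thesis
      by (rule tr[OF assms(3) _ e assms(2) assms(1)]) auto
  qed
qed

text \<open>Up to translation an ordered triple is determined by its two steps; the translation has
  to carry \<open>a\<close> to \<open>x\<close>. This is used for \<open>(0, 1, 2)\<close> and
  \<open>(2, 1, 0)\<close>.\<close>

lemma translate_triple_iff_step_pair:
  assumes "x \<in> Zn n" "y \<in> Zn n" "z \<in> Zn n"
  shows "(\<exists>t\<in>Zn n. (x, y, z) = translate_triple n t (a, b, c)) \<longleftrightarrow>
    step_pair n (x, y, z) = mod_pair n (b - a, c - b)"
proof
  assume "\<exists>t\<in>Zn n. (x, y, z) = translate_triple n t (a, b, c)"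
  then show "step_pair n (x, y, z) = mod_pair n (b - a, c - b)"
    by (auto simp: mod_pair_def mod_diff_eq)
next
  let ?N = "int n"
  assume "step_pair n (x, y, z) = mod_pair n (b - a, c - b)"
  then have yz: "(y - x) mod ?N = (b - a) mod ?N" "(z - y) mod ?N = (c - b) mod ?N"
    by (auto simp: mod_pair_def)
  define t where "t = (x - a) mod ?N"
  have y: "y = ((b - a) + x) mod ?N"
    using assms yz by (intro eq_mod_of_cong_diff) (auto simp: Zn_def)
  have "z = ((c - b) + y) mod ?N"
    using assms yz by (intro eq_mod_of_cong_diff) (auto simp: Zn_def)
  then have "z = ((c - b) + ((b - a) + x)) mod ?N" by (metis mod_add_right_eq y)
  then have "z = ((c - a) + x) mod ?N" by (simp add: algebra_simps)
  with y have "(x, y, z) = translate_triple n t (a, b, c)"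
    using assms by (auto simp: t_def Zn_def mod_simps algebra_simps)
  moreover have "t \<in> Zn n" using assms by (auto simp: t_def Zn_def)
  ultimately show "\<exists>t\<in>Zn n. (x, y, z) = translate_triple n t (a, b, c)" by blast
qed

section \<open>Arc words of cycles\<close>

lemma window_in_Zn:
  assumes "set c \<subseteq> Zn n" "c \<noteq> []" "window c i = (x, y, z)"
  shows "x \<in> Zn n" "y \<in> Zn n" "z \<in> Zn n"
  using assms(2,3) subsetD[OF assms(1) nth_mem]
  by (auto simp: window_def)

lemma realizes_iff_step_pair:
  assumes "set c \<subseteq> Zn n" "k \<in> class_indices n" "n \<ge> 2"
  shows "realizes n c i k \<longleftrightarrow> i < length c \<and> step_pair n (window c i) \<in> forms n k"
proof (cases "i < length c")
  case True
  then have ne: "c \<noteq> []" by auto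
  obtain x y z where w: "window c i = (x, y, z)" by (cases "window c i")
  show ?thesis
    using triple_set_in_trichord_class_iff[OF window_in_Zn[OF assms(1) ne w] assms(2,3)] True w
    by (simp add: realizes_def)
qed (simp add: realizes_def)

text \<open>The list \<open>es\<close> names the classes in the order in which the windows of
  \<open>c\<close> realize them. That each class has exactly one window is expressed by
  \<open>es\<close> being a distinct enumeration of the indices. The list turns out to be
  \<open>cycle_arcs n c\<close>.\<close>

definition arc_word :: "nat \<Rightarrow> int list \<Rightarrow> nat list \<Rightarrow> bool" where
  "arc_word n c es \<longleftrightarrow>
     set c \<subseteq> Zn n \<and> c ! 0 = 0 \<and> length c = length es \<and>
     distinct es \<and> set es = class_indices n \<and>
     (\<forall>i<length es. step_pair n (window c i) \<in> forms n (es ! i))"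

lemma length_arc_list:
  assumes "distinct es" "set es = class_indices n" "n \<ge> 4"
  shows "length es = n - 3"
  using distinct_card[OF assms(1)] assms(2,3) by (simp add: class_indices_def)

text \<open>Sending a class to the position of its window is injective, since a step pair is a form
  of only one class. There are as many classes as positions, so this is a bijection, and its inverse
  gives \<open>es\<close>.\<close>

lemma labelled_cycle_arc_word_ex:
  assumes c: "labelled_cycle n c" and n: "n \<ge> 4"
  obtains es where "arc_word n c es"
proof -
  let ?K = "class_indices n"
  have tc: "length c = n - 3" "set c \<subseteq> Zn n" "\<And>k. k \<in> ?K \<Longrightarrow> \<exists>!i. realizes n c i k" "c ! 0 = 0"
    using c by (auto simp: labelled_cycle_def trichord_cycle_def)
  have cardK: "card ?K = n - 3" "finite ?K" using n by (auto simp: class_indices_def)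
  define g where "g k = (THE i. realizes n c i k)" for k
  have g: "realizes n c (g k) k" if "k \<in> ?K" for k
    using theI'[OF tc(3)[OF that]] by (simp add: g_def)
  have gf: "g k < n - 3 \<and> step_pair n (window c (g k)) \<in> forms n k" if "k \<in> ?K" for k
    using g[OF that] realizes_iff_step_pair[OF tc(2) that] n tc(1) by simp
  have inj: "inj_on g ?K"
  proof (rule inj_onI)
    fix k l assume "k \<in> ?K" "l \<in> ?K" "g k = g l"
    then show "k = l"
      using gf[of k] gf[of l] n by (intro forms_disjoint[of "step_pair n (window c (g k))"]) auto
  qed
  have "g ` ?K = {..<n - 3}"
    using gf by (intro card_subset_eq) (auto simp: card_image[OF inj] cardK)
  then have bij: "bij_betw g ?K {..<n - 3}" using inj by (simp add: bij_betw_def)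
  define es where "es = map (inv_into ?K g) [0..<n - 3]"
  have bij': "bij_betw (inv_into ?K g) {..<n - 3} ?K" using bij by (rule bij_betw_inv_into)
  have "distinct es" "set es = ?K"
    using bij' by (auto simp: es_def distinct_map bij_betw_def atLeast0LessThan)
  moreover have "step_pair n (window c i) \<in> forms n (es ! i)" if "i < n - 3" for i
  proof -
    have "inv_into ?K g i \<in> ?K" "g (inv_into ?K g i) = i"
      using that bij by (auto simp: bij_betw_def inv_into_into f_inv_into_f)
    then show ?thesis using gf[of "inv_into ?K g i"] that by (simp add: es_def)
  qed
  ultimately have "arc_word n c es"
    using tc by (simp add: arc_word_def es_def)
  then show thesis by (rule that)
qed

lemma arc_word_realizes_iff:
  assumes "arc_word n c es" "i < length es" "k \<in> class_indices n" "n \<ge> 2"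
  shows "realizes n c i k \<longleftrightarrow> es ! i = k"
proof -
  have "es ! i \<in> class_indices n" using assms nth_mem by (auto simp: arc_word_def)
  then show ?thesis
    using assms realizes_iff_step_pair[of c n k i]
      forms_disjoint[of "step_pair n (window c i)" n "es ! i" k]
    by (auto simp: arc_word_def simp del: step_pair.simps)
qed

text \<open>Evaluates the \<open>THE\<close> in \<open>realizing_window\<close>; distinctness of
  \<open>es\<close> gives the uniqueness.\<close>

lemma arc_word_realizes_nth_iff:
  assumes "arc_word n c es" "i < length es" "n \<ge> 2"
  shows "realizes n c j (es ! i) \<longleftrightarrow> j = i"
proof (cases "j < length es")
  case True
  have "es ! i \<in> class_indices n" using assms nth_mem by (auto simp: arc_word_def)
  then show ?thesis
    using arc_word_realizes_iff[OF assms(1) True _ assms(3)] assms True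
    by (auto simp: arc_word_def nth_eq_iff_index_eq)
next
  case False
  then show ?thesis using assms by (auto simp: arc_word_def realizes_def)
qed

text \<open>Windows have three elements because their step pairs are forms, and the only window of a
  class sits at the position of that class in \<open>es\<close>.\<close>

lemma arc_word_labelled_cycle:
  assumes w: "arc_word n c es" and n: "n \<ge> 4"
  shows "labelled_cycle n c"
proof -
  have len: "length es = n - 3" using w n by (auto simp: arc_word_def intro: length_arc_list)
  have "card (triple_set (window c i)) = 3" if "i < length c" for i
    using that w n nth_mem[of i es]
    by (intro card_triple_set_of_forms[of _ _ "es ! i"]) (auto simp: arc_word_def)
  moreover have "\<exists>!i. realizes n c i k" if k: "k \<in> class_indices n" for k
  proof -
    have "k \<in> set es" using k w by (simp add: arc_word_def)
    then obtain i where "i < length es" "k = es ! i" by (metis in_set_conv_nth)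
    then show ?thesis using arc_word_realizes_nth_iff[OF w] n by auto
  qed
  ultimately show ?thesis
    using w len by (simp add: labelled_cycle_def trichord_cycle_def arc_word_def)
qed

lemma arc_word_cycle_choice:
  assumes w: "arc_word n c es" and i: "i < length es" and n: "n \<ge> 2"
  shows "cycle_choice n c (es ! i) = step_pair n (window c i)"
proof -
  have "es ! i \<in> class_indices n" using assms nth_mem by (auto simp: arc_word_def)
  moreover have "(THE j. realizes n c j (es ! i)) = i"
    using arc_word_realizes_nth_iff[OF w i n] by simp
  ultimately show ?thesis by (simp add: cycle_choice_def realizing_window_def)
qed

lemma arc_word_cycle_choice_in:
  assumes w: "arc_word n c es" and n: "n \<ge> 2"
  shows "cycle_choice n c \<in> choice_functions n"
proof -
  have "cycle_choice n c k \<in> forms n k" if "k \<in> class_indices n" for k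
  proof -
    have "k \<in> set es" using that w by (simp add: arc_word_def)
    then obtain i where "i < length es" "k = es ! i" by (metis in_set_conv_nth)
    then show ?thesis using arc_word_cycle_choice[OF w _ n] w by (simp add: arc_word_def)
  qed
  then show ?thesis by (auto simp: choice_functions_def cycle_choice_def)
qed

text \<open>The \<open>THE\<close> in \<open>cycle_arcs\<close> picks \<open>es ! i\<close>: another
  arc with the same ends would give a form shared by two classes.\<close>

lemma arc_word_cycle_arcs:
  assumes w: "arc_word n c es" and n: "n \<ge> 2"
  shows "cycle_arcs n c = es"
proof (rule nth_equalityI)
  show len: "length (cycle_arcs n c) = length es"
    using w by (simp add: cycle_arcs_def arc_word_def)
  fix i assume "i < length (cycle_arcs n c)"
  then have i: "i < length es" "i < length c" using len w by (auto simp: arc_word_def)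
  let ?F = "cycle_choice n c"
  have esi: "es ! i \<in> class_indices n" using w i nth_mem by (auto simp: arc_word_def)
  have F: "?F k \<in> forms n k" if "k \<in> class_indices n" for k
    using arc_word_cycle_choice_in[OF w n] that by (auto simp: choice_functions_def)
  have "(THE e. e \<in> class_indices n \<and> ?F e = step_pair n (window c i)) = es ! i"
  proof (rule the_equality)
    show "es ! i \<in> class_indices n \<and> ?F (es ! i) = step_pair n (window c i)"
      using esi arc_word_cycle_choice[OF w i(1) n] by simp
    fix e assume e: "e \<in> class_indices n \<and> ?F e = step_pair n (window c i)"
    have "?F (es ! i) = ?F e" using e arc_word_cycle_choice[OF w i(1) n] by simp
    then show "e = es ! i"
      using forms_disjoint[OF _ _ _ esi n] F esi e by metis
  qed
  then show "cycle_arcs n c ! i = es ! i"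
    using i(2) by (simp add: cycle_arcs_def choice_graph_def arc_to_ends_def)
qed

section \<open>Eulerian circuits of choice graphs\<close>

text \<open>For \<open>n \<ge> 4\<close> the index \<open>2\<close> provides an arc, as
  \<open>euler_circuit_list_iff\<close> demands.\<close>

lemma euler_circuit_list_choice_graph_iff:
  assumes "n \<ge> 4"
  shows "euler_circuit_list (choice_graph n F) es \<longleftrightarrow>
    distinct es \<and> set es = class_indices n \<and>
    (\<forall>i<length es. snd (F (es ! i)) = fst (F (es ! (Suc i mod length es))))"
  using assms by (subst euler_circuit_list_iff) (auto simp: choice_graph_def class_indices_def)

lemma wf_choice_graph: "wf_digraph (choice_graph n F)"
  by unfold_locales (auto simp: choice_graph_def)

text \<open>Both sides are the step from the second to the third letter of window \<open>i\<close>.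
  This makes consecutive arcs meet head to tail, also across the end of the word.\<close>

lemma step_pair_window_overlap:
  assumes "i < length c"
  shows "snd (step_pair n (window c i)) = fst (step_pair n (window c (Suc i mod length c)))"
  using assms by (simp add: window_def mod_simps)

lemma sum_set_nth: "distinct xs \<Longrightarrow> sum f (set xs) = (\<Sum>i<length xs. f (xs ! i))"
  by (rule sum.reindex_bij_betw[OF bij_betw_nth, symmetric]) auto

lemma sum_shift_mod:
  fixes f :: "nat \<Rightarrow> 'a::ab_group_add"
  shows "(\<Sum>i<m. f (Suc i mod m) - f i) = 0"
proof (cases m)
  case (Suc l)
  \<comment> \<open>The last summand wraps around to \<open>f 0 - f l\<close>; the others telescope
    to \<open>f l - f 0\<close>.\<close>
  have "(\<Sum>i<m. f (Suc i mod m) - f i) = (\<Sum>i<l. f (Suc i) - f i) + (f 0 - f l)"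
    by (simp add: Suc)
  also have "\<dots> = 0" by (simp add: sum_lessThan_telescope)
  finally show ?thesis .
qed simp

section \<open>From cycles to Eulerian circuits and back\<close>

lemma arc_word_euler_circuit_list:
  assumes w: "arc_word n c es" and n: "n \<ge> 4"
  shows "euler_circuit_list (choice_graph n (cycle_choice n c)) es"
proof -
  have "snd (cycle_choice n c (es ! i)) = fst (cycle_choice n c (es ! (Suc i mod length es)))"
    if "i < length es" for i
  proof -
    have "Suc i mod length es < length es" using that by (intro mod_less_divisor) linarith
    then show ?thesis
      using step_pair_window_overlap[of i c n] arc_word_cycle_choice[OF w] that n w
      by (simp add: arc_word_def)
  qed
  then show ?thesis
    using w n by (simp add: euler_circuit_list_choice_graph_iff arc_word_def)
qed

lemma arc_word_valid_choice:
  assumes w: "arc_word n c es" and n: "n \<ge> 4"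
  shows "valid_choice n (cycle_choice n c)"
proof -
  let ?F = "cycle_choice n c" let ?G = "choice_graph n ?F"
  interpret wf_digraph ?G by (rule wf_choice_graph)
  obtain u where u: "euler_trail u es u"
    using arc_word_euler_circuit_list[OF w n] by (auto simp: euler_circuit_list_def)
  then have "connected ?G" by (rule euler_imp_connected)
  moreover have "balanced_choice n ?F"
  proof -
    have "trail u es u" "set es = arcs ?G" using u by (auto simp: euler_trail_def)
    \<comment> \<open>The trail starts and ends at the same \<open>u\<close>, so no vertex carries
      the imbalance of an open trail.\<close>
    then have "arc_set_balanced u (arcs ?G) u" using arc_balancedI_trail by metis
    then show ?thesis by (simp add: balanced_choice_def arc_set_balanced_all)
  qed
  moreover have "closed_choice n ?F"
  proof -
    have es: "distinct es" "set es = class_indices n" "length c = length es"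
      using w by (auto simp: arc_word_def)
    have "(\<Sum>k\<in>class_indices n. fst (?F k)) = (\<Sum>i<length es. fst (?F (es ! i)))"
      using sum_set_nth[OF es(1)] es(2) by simp
    also have "\<dots> = (\<Sum>i<length es. (c ! (Suc i mod length es) - c ! i) mod int n)"
      using es n by (intro sum.cong) (auto simp: arc_word_cycle_choice[OF w] window_def)
    \<comment> \<open>Reducing the summands does not change the sum modulo \<open>n\<close>;
      unreduced, the differences cancel around the cycle.\<close>
    also have "[\<dots> = (\<Sum>i<length es. c ! (Suc i mod length es) - c ! i)] (mod int n)"
      by (intro cong_sum) (simp add: cong_def)
    also have "(\<Sum>i<length es. c ! (Suc i mod length es) - c ! i) = 0"
      by (rule sum_shift_mod)
    finally show ?thesis by (simp add: closed_choice_def)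
  qed
  ultimately show ?thesis
    using arc_word_cycle_choice_in[OF w] n by (simp add: valid_choice_def)
qed

text \<open>The letters are the partial sums of the tails along \<open>es\<close>. Closedness makes
  them periodic modulo \<open>n\<close>, and as the head of each arc is the tail of the next, both
  steps of each window come out right.\<close>

lemma valid_euler_arc_word_ex:
  assumes F: "valid_choice n F" and E: "euler_circuit_list (choice_graph n F) es" and n: "n \<ge> 4"
  obtains c where "arc_word n c es" "cycle_choice n c = F"
proof -
  let ?m = "length es" let ?N = "int n"
  have es: "distinct es" "set es = class_indices n"
    and next_arc: "\<And>i. i < ?m \<Longrightarrow> snd (F (es ! i)) = fst (F (es ! (Suc i mod ?m)))"
    using E by (auto simp: euler_circuit_list_choice_graph_iff[OF n])
  have m: "?m > 0" using length_arc_list[OF es n] n by simp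
  have Fk: "F k \<in> forms n k" if "k \<in> class_indices n" for k
    using F that by (auto simp: valid_choice_def choice_functions_def)
  have Fe: "F (es ! i) \<in> forms n (es ! i)" if "i < ?m" for i
    using Fk that es nth_mem by blast
  \<comment> \<open>The index is cyclic, so that \<open>a (Suc i)\<close> is also correct at the
    last arc.\<close>
  define a where "a j = fst (F (es ! (j mod ?m)))" for j
  \<comment> \<open>The empty sum \<open>P 0 = 0\<close> makes the word start with
    \<open>0\<close>.\<close>
  define P where "P i = (\<Sum>j<i. a j)" for i
  define c where "c = map (\<lambda>i. P i mod ?N) [0..<?m]"
  have "(\<Sum>k\<in>class_indices n. fst (F k)) = P ?m"
    using sum_set_nth[OF es(1)] es(2) by (simp add: P_def a_def)
  then have "P ?m mod ?N = 0"
    using F by (simp add: valid_choice_def closed_choice_def cong_def)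
  \<comment> \<open>By closedness one full turn adds \<open>0\<close> modulo \<open>n\<close>, so
    \<open>P\<close> has period \<open>?m\<close> modulo \<open>n\<close>.\<close>
  then have per: "P (?m + i) mod ?N = P i mod ?N" for i
  proof (induction i)
    case (Suc i)
    have "a (?m + i) = a i" by (simp add: a_def)
    with Suc show ?case by (simp add: P_def mod_simps) (metis mod_add_left_eq)
  qed (simp add: P_def)
  have P_mod: "P (i mod ?m) mod ?N = P i mod ?N" for i
  proof (induction i rule: less_induct)
    case (less i)
    show ?case
    proof (cases "i < ?m")
      case False
      with m have "i - ?m < i" by linarith
      with False show ?thesis using less[of "i - ?m"] per[of "i - ?m"] by (simp add: le_mod_geq)
    qed simp
  qed
  have c: "c ! (i mod ?m) = P i mod ?N" for i
    using P_mod m by (simp add: c_def)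
  have lc: "length c = ?m" by (simp add: c_def)
  have step: "step_pair n (window c i) = F (es ! i)" if i: "i < ?m" for i
  proof -
    obtain p q where pq: "F (es ! i) = (p, q)" by (cases "F (es ! i)")
    have ei: "es ! i \<in> class_indices n" using es(2) i nth_mem by blast
    \<comment> \<open>Entries of forms are already reduced, so the step pair equals
      \<open>F (es ! i)\<close> and is not merely congruent to it.\<close>
    have b: "p mod ?N = p" "q mod ?N = q"
      using forms_bounds[OF Fe[OF i, unfolded pq] ei] n by auto
    have ap: "a i = p" using pq i by (simp add: a_def)
    have aq: "a (Suc i) = q" using pq next_arc[OF i] by (simp add: a_def)
    show ?thesis
      using b by (simp add: window_def lc c pq P_def ap aq mod_diff_eq)
  qed
  have w: "arc_word n c es"
    unfolding arc_word_def using es lc step Fe m n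
    by (auto simp: c_def Zn_def P_def)
  have "cycle_choice n c = F"
  \<comment> \<open>Both functions are \<open>undefined\<close> off the indices, so agreement on the
    indices suffices.\<close>
  proof (rule extensionalityI[of _ "class_indices n"])
    show "cycle_choice n c \<in> extensional (class_indices n)" by (simp add: cycle_choice_def)
    show "F \<in> extensional (class_indices n)"
      using F by (auto simp: valid_choice_def choice_functions_def PiE_def)
    fix k assume "k \<in> class_indices n"
    then obtain i where "i < ?m" "k = es ! i" using es by (metis in_set_conv_nth)
    then show "cycle_choice n c k = F k" using arc_word_cycle_choice[OF w] step n by simp
  qed
  with w show thesis by (rule that)
qed

text \<open>The first letter is \<open>0\<close>, and the step to each next letter is prescribed by
  \<open>es\<close> and the common choice function.\<close>

lemma arc_word_unique:
  assumes w: "arc_word n c es" and w': "arc_word n c' es"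
    and F: "cycle_choice n c = cycle_choice n c'" and n: "n \<ge> 4"
  shows "c = c'"
proof (rule nth_equalityI)
  show len: "length c = length c'" using w w' by (simp add: arc_word_def)
  have Zn: "c ! i \<in> Zn n" "c' ! i \<in> Zn n" if "i < length c" for i
    using that w w' len nth_mem by (auto simp: arc_word_def)
  fix i assume "i < length c"
  then show "c ! i = c' ! i"
  proof (induction i)
    case 0
    then show ?case using w w' by (simp add: arc_word_def)
  next
    case (Suc i)
    have "i < length es" using Suc w by (simp add: arc_word_def)
    then have "step_pair n (window c i) = step_pair n (window c' i)"
      using arc_word_cycle_choice[OF w] arc_word_cycle_choice[OF w'] F n by simp
    then have "(c ! Suc i - c ! i) mod int n = (c' ! Suc i - c ! i) mod int n"
      using Suc len by (simp add: window_def)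
    then have "c ! Suc i = ((c' ! Suc i - c ! i) + c ! i) mod int n"
      using Zn[OF Suc.prems] by (intro eq_mod_of_cong_diff) (auto simp: Zn_def)
    then show ?case using Zn[OF Suc.prems] by (simp add: Zn_def)
  qed
qed

section \<open>Rotation classes\<close>

lemma self_in_rotation_class: "es \<in> rotation_class es"
  unfolding rotation_class_def by (metis rangeI rotate0 id_apply)

text \<open>Rotations are invertible, so the list representing a circuit can be changed to begin at
  any chosen arc.\<close>

lemma rotation_class_rotate: "rotation_class (rotate r es) = rotation_class es"
proof -
  have 1: "rotation_class (rotate r xs) \<subseteq> rotation_class xs" for r and xs :: "'a list"
    by (auto simp: rotation_class_def rotate_rotate)
  \<comment> \<open>The complementary rotation undoes \<open>r\<close>; as \<open>r\<close> may
    exceed the length, it is reduced first.\<close>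
  have "rotate (length es - r mod length es) (rotate r es) = es"
  proof (cases "es = []")
    case False
    then show ?thesis
      by (metis rotate_conv_mod rotate_rotate le_add_diff_inverse2 mod_less_divisor
          length_greater_0_conv less_imp_le_nat mod_add_right_eq mod_self rotate0 id_apply)
  qed simp
  then have "rotation_class es \<subseteq> rotation_class (rotate r es)"
    using 1 by metis
  with 1 show ?thesis by blast
qed

text \<open>The first entry of \<open>rotate r xs\<close> is \<open>xs ! (r mod length xs)\<close>,
  and in a distinct list this is \<open>xs ! 0\<close> only when the rotation is trivial.\<close>

lemma rotation_class_nth_0_inj:
  assumes "distinct xs" "xs \<noteq> []" "rotation_class xs = rotation_class ys" "xs ! 0 = ys ! 0"
  shows "xs = ys"
proof -
  obtain r where ys: "ys = rotate r xs"
    using self_in_rotation_class[of ys] assms(3) by (auto simp: rotation_class_def)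
  then have "xs ! (r mod length xs) = xs ! 0"
    using assms(2,4) by (simp add: nth_rotate)
  then have "r mod length xs = 0"
    using assms(1,2) by (simp add: nth_eq_iff_index_eq)
  then show ?thesis using ys by (metis rotate_conv_mod rotate0 id_apply)
qed

text \<open>The circuit condition treats positions cyclically, so it is invariant under a shift by
  \<open>r\<close>.\<close>

lemma euler_circuit_list_rotate:
  assumes n: "n \<ge> 4" and E: "euler_circuit_list (choice_graph n F) es"
  shows "euler_circuit_list (choice_graph n F) (rotate r es)"
proof -
  let ?m = "length es"
  have es: "distinct es" "set es = class_indices n"
    and next_arc: "\<And>i. i < ?m \<Longrightarrow> snd (F (es ! i)) = fst (F (es ! (Suc i mod ?m)))"
    using E by (auto simp: euler_circuit_list_choice_graph_iff[OF n])
  have "snd (F (rotate r es ! i)) = fst (F (rotate r es ! (Suc i mod ?m)))" if i: "i < ?m" for i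
  proof -
    have "Suc i mod ?m < ?m" "(r + i) mod ?m < ?m" using i by (auto intro!: mod_less_divisor)
    then show ?thesis
      using next_arc[of "(r + i) mod ?m"] i by (simp add: nth_rotate mod_simps)
  qed
  then show ?thesis using es by (simp add: euler_circuit_list_choice_graph_iff[OF n])
qed

section \<open>The correspondence\<close>

lemma arc_word_correspondence:
  assumes "arc_word n c es" "n \<ge> 2"
  shows "correspondence n c = (cycle_choice n c, rotation_class es, es ! 0)"
  using arc_word_cycle_arcs[OF assms] by (simp add: correspondence_def)

lemma arc_word_ne: "arc_word n c es \<Longrightarrow> n \<ge> 4 \<Longrightarrow> es \<noteq> []"
  using length_arc_list[of es n] by (auto simp: arc_word_def)

lemma bij_betw_correspondence:
  assumes n: "n \<ge> 4"
  shows "bij_betw (correspondence n) {c. labelled_cycle n c}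
    (SIGMA F:{F. valid_choice n F}. rooted_circuits (choice_graph n F))"
proof (rule bij_betw_imageI)
  have n2: "n \<ge> 2" using n by simp
  show "inj_on (correspondence n) {c. labelled_cycle n c}"
  proof (rule inj_onI)
    fix c c'
    assume "c \<in> {c. labelled_cycle n c}" "c' \<in> {c. labelled_cycle n c}"
      and eq: "correspondence n c = correspondence n c'"
    then obtain es es' where w: "arc_word n c es" and w': "arc_word n c' es'"
      using labelled_cycle_arc_word_ex n by (metis mem_Collect_eq)
    note eq' = eq[unfolded arc_word_correspondence[OF w n2] arc_word_correspondence[OF w' n2]]
    \<comment> \<open>The circuit and its starting arc give back the arc list; with the choice
      function it then determines the word.\<close>
    have "es = es'"
      using eq' w arc_word_ne[OF w n] by (intro rotation_class_nth_0_inj) (auto simp: arc_word_def)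
    then show "c = c'" using arc_word_unique[OF w] w' eq' n by simp
  qed
  show "correspondence n ` {c. labelled_cycle n c} =
    (SIGMA F:{F. valid_choice n F}. rooted_circuits (choice_graph n F))" (is "?L = ?R")
  proof
    show "?L \<subseteq> ?R"
    proof (rule image_subsetI)
      fix c assume "c \<in> {c. labelled_cycle n c}"
      then have c: "labelled_cycle n c" by simp
      obtain es where w: "arc_word n c es" using labelled_cycle_arc_word_ex[OF c n] .
      have "es ! 0 \<in> class_indices n"
        using w arc_word_ne[OF w n] by (metis arc_word_def length_greater_0_conv nth_mem)
      moreover have "rotation_class es \<in> euler_circuits (choice_graph n (cycle_choice n c))"
        using arc_word_euler_circuit_list[OF w n] by (auto simp: euler_circuits_def)
      ultimately show "correspondence n c \<in> ?R"
        using arc_word_valid_choice[OF w n] unfolding arc_word_correspondence[OF w n2]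
        by (simp add: rooted_circuits_def choice_graph_def)
    qed
    show "?R \<subseteq> ?L"
    proof
      fix p assume "p \<in> ?R"
      then obtain F C e where p: "p = (F, C, e)" and F: "valid_choice n F"
        and "(C, e) \<in> rooted_circuits (choice_graph n F)"
        by (cases p) auto
      then obtain es where E: "euler_circuit_list (choice_graph n F) es"
        and C: "C = rotation_class es" and "e \<in> class_indices n"
        by (auto simp: rooted_circuits_def euler_circuits_def choice_graph_def)
      then obtain r where r: "r < length es" "e = es ! r"
        by (metis euler_circuit_list_choice_graph_iff[OF n] in_set_conv_nth)
      \<comment> \<open>Rotating the representative to begin at \<open>e\<close> keeps its class and
        puts the distinguished arc first.\<close>
      obtain c where w: "arc_word n c (rotate r es)" and c: "cycle_choice n c = F"
        using valid_euler_arc_word_ex[OF F euler_circuit_list_rotate[OF n E] n] .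
      have "rotate r es ! 0 = e" using r nth_rotate[of 0 es r] by (cases es) auto
      then have "correspondence n c = (F, C, e)"
        by (simp add: arc_word_correspondence[OF w n2] c C rotation_class_rotate)
      then show "p \<in> ?L"
        unfolding p using arc_word_labelled_cycle[OF w n] by (metis image_eqI mem_Collect_eq)
    qed
  qed
qed

section \<open>Finiteness and counting\<close>

lemma finite_labelled_cycles: "finite {c. labelled_cycle n c}"
  by (rule finite_subset[OF _ finite_lists_length_eq[of "Zn n" "n - 3"]])
    (auto simp: labelled_cycle_def trichord_cycle_def Zn_def)

text \<open>Choice functions are \<open>undefined\<close> off a finite index set, and each class has
  finitely many forms.\<close>

lemma finite_valid_choices: "finite {F. valid_choice n F}"
proof (rule finite_subset)
  show "{F. valid_choice n F} \<subseteq> choice_functions n" by (auto simp: valid_choice_def)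
  show "finite (choice_functions n)"
    by (auto simp: choice_functions_def class_indices_def forms_def intro!: finite_PiE)
qed

lemma finite_euler_circuits:
  assumes "finite (arcs G)"
  shows "finite (euler_circuits G)"
proof -
  have "{es. euler_circuit_list G es} \<subseteq> {es. set es \<subseteq> arcs G \<and> distinct es}"
    by (auto simp: euler_circuit_list_def pre_digraph.euler_trail_def pre_digraph.trail_def)
  then show ?thesis
    unfolding euler_circuits_def
    by (intro finite_imageI) (rule finite_subset[OF _ finite_subset_distinct[OF assms]])
qed

lemma finite_rooted_circuits: "finite (rooted_circuits (choice_graph n F))"
  unfolding rooted_circuits_def
  by (intro finite_cartesian_product finite_euler_circuits)
    (simp_all add: choice_graph_def class_indices_def)

lemma card_rooted_circuits:
  assumes "n \<ge> 4"
  shows "card (rooted_circuits (choice_graph n F)) = (n - 3) * ec (choice_graph n F)"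
  using assms by (simp add: rooted_circuits_def ec_def card_cartesian_product choice_graph_def
      class_indices_def mult.commute)

text \<open>Scalar and zigzag cycles partition the labelled cycles; the correspondence counts these
  by choice function, each circuit having \<open>n - 3\<close> possible starting arcs.\<close>

lemma num_scalar_plus_num_zigzag:
  assumes n: "n \<ge> 4"
  shows "num_scalar n + num_zigzag n = (\<Sum>F | valid_choice n F. (n - 3) * ec (choice_graph n F))"
proof -
  have "num_scalar n + num_zigzag n = card ({c. labelled_cycle n c \<and> scalar_cycle n c} \<union>
      {c. labelled_cycle n c \<and> zigzag_cycle n c})"
    unfolding num_scalar_def num_zigzag_def
    by (intro card_Un_disjoint[symmetric])
      (auto intro: finite_subset[OF _ finite_labelled_cycles] simp: zigzag_cycle_def)
  also have "\<dots> = card {c. labelled_cycle n c}"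
    by (rule arg_cong[where f = card]) (auto simp: zigzag_cycle_def)
  also have "\<dots> = card (SIGMA F:{F. valid_choice n F}. rooted_circuits (choice_graph n F))"
    by (rule bij_betw_same_card[OF bij_betw_correspondence[OF n]])
  also have "\<dots> = (\<Sum>F | valid_choice n F. (n - 3) * ec (choice_graph n F))"
    using finite_valid_choices finite_rooted_circuits
    by (simp add: card_SigmaI card_rooted_circuits[OF n])
  finally show ?thesis .
qed

text \<open>The steps of \<open>(0, 1, 2)\<close> are \<open>(1, 1)\<close>, those of
  \<open>(2, 1, 0)\<close> are \<open>(-1, -1)\<close>, and the step pair determines an ordered
  window up to translation.\<close>

lemma scalar_cycle_iff:
  assumes c: "labelled_cycle n c" and n: "n \<ge> 4"
  shows "scalar_cycle n c \<longleftrightarrow>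
    cycle_choice n c 2 \<in> {mod_pair n (1, 1), mod_pair n (- 1, - 1)}"
proof -
  obtain x y z where w: "realizing_window n c 2 = (x, y, z)" by (cases "realizing_window n c 2")
  have "set c \<subseteq> Zn n" "c \<noteq> []" using c n by (auto simp: labelled_cycle_def trichord_cycle_def)
  then have Zn: "x \<in> Zn n" "y \<in> Zn n" "z \<in> Zn n"
    using window_in_Zn w unfolding realizing_window_def by blast+
  have "2 \<in> class_indices n" using n by (simp add: class_indices_def)
  then have "cycle_choice n c 2 = step_pair n (x, y, z)" by (simp add: cycle_choice_def w)
  then show ?thesis
    using translate_triple_iff_step_pair[OF Zn, of 0 1 2]
      translate_triple_iff_step_pair[OF Zn, of 2 1 0]
    unfolding scalar_cycle_def w by auto
qed

theorem theorem5p2: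
  fixes n m :: nat
  assumes "n \<ge> 6" and "m = n - 3"
  shows
    "bij_betw (correspondence n)
       {c. labelled_cycle n c}
       (SIGMA F:{F. valid_choice n F}. rooted_circuits (choice_graph n F))
     \<and> (\<forall>c. labelled_cycle n c \<longrightarrow>
          length (cycle_arcs n c) = m \<and>
          euler_circuit_list (choice_graph n (cycle_choice n c)) (cycle_arcs n c) \<and>
          (\<forall>i<m. arc_to_ends (choice_graph n (cycle_choice n c)) (cycle_arcs n c ! i)
                  = step_pair n (window c i)))
     \<and> num_scalar n + num_zigzag n
         = (\<Sum>F | valid_choice n F. m * ec (choice_graph n F))
     \<and> (\<forall>c. labelled_cycle n c \<longrightarrow>
          (scalar_cycle n c \<longleftrightarrow>
             cycle_choice n c 2 \<in> {mod_pair n (1, 1), mod_pair n (- 1, - 1)}) \<and>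
          (zigzag_cycle n c \<longleftrightarrow>
             cycle_choice n c 2 \<notin> {mod_pair n (1, 1), mod_pair n (- 1, - 1)}))"
proof (intro conjI allI impI)
  have n: "n \<ge> 4" "n \<ge> 2" using assms(1) by auto
  show "bij_betw (correspondence n) {c. labelled_cycle n c}
       (SIGMA F:{F. valid_choice n F}. rooted_circuits (choice_graph n F))"
    by (rule bij_betw_correspondence[OF n(1)])
  show "num_scalar n + num_zigzag n = (\<Sum>F | valid_choice n F. m * ec (choice_graph n F))"
    using num_scalar_plus_num_zigzag[OF n(1)] assms(2) by simp
  fix c assume c: "labelled_cycle n c"
  show "scalar_cycle n c \<longleftrightarrow>
      cycle_choice n c 2 \<in> {mod_pair n (1, 1), mod_pair n (- 1, - 1)}"
    and "zigzag_cycle n c \<longleftrightarrow>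
      cycle_choice n c 2 \<notin> {mod_pair n (1, 1), mod_pair n (- 1, - 1)}"
    using scalar_cycle_iff[OF c n(1)] by (auto simp: zigzag_cycle_def)
  obtain es where w: "arc_word n c es" using labelled_cycle_arc_word_ex[OF c n(1)] .
  note es = arc_word_cycle_arcs[OF w n(2)]
  show len: "length (cycle_arcs n c) = m"
    using w c assms by (simp add: cycle_arcs_def labelled_cycle_def trichord_cycle_def)
  show "euler_circuit_list (choice_graph n (cycle_choice n c)) (cycle_arcs n c)"
    unfolding es by (rule arc_word_euler_circuit_list[OF w n(1)])
  fix i assume "i < m"
  then show "arc_to_ends (choice_graph n (cycle_choice n c)) (cycle_arcs n c ! i)
      = step_pair n (window c i)"
    using arc_word_cycle_choice[OF w _ n(2), of i] len es
    by (simp add: arc_to_ends_def choice_graph_def)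
qed

end
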